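(* Consider the distributed multi-task learning setting, the adapt-then-combine (ATC) diffusion algorithm and Assumptions 1--3, all described in the context. A normal agent $k$ which runs the ATC diffusion algorithm using the loss-based weights $$a_{lk}(i)=\begin{cases}\dfrac{r_k(\hat\theta_{l,i})^{-1}}{\sum_{p\in\mathcal N_k^{\le}} r_k(\hat\theta_{p,i})^{-1}}, & \text{if } r_k(\hat\theta_{l,i})\le r_k(\hat\theta_{k,i}),\\[2mm] 0,&\text{otherwise,}\end{cases}\qquad l\in\mathcal N_k,$$ where $\mathcal N_k^{\le}$ is the set of neighbors $l\in\mathcal N_k$ with $r_k(\hat\theta_{l,i})\le r_k(\hat\theta_{k,i})$, converges towards $\theta_k^*$ with $$\lim_{i\to\infty}\mathbb E\left[r_k(\theta_{k,i})-r_k(\theta_k^* )\right]\le\frac{\mu_k L\sigma_k^2}{2m},$$ for fixed step size $\mu_k\in\left(0,\frac{1}{Lc_k}\right]$, in the presence of an arbitrary number of Byzantine neighbors. Further, it holds that $$\mathbb E\left[r_k(\theta_{k,i})-r_k(\theta_k^* )\right]\le\mathbb E\left[r_k(\hat\theta_{k,i})-r_k(\theta_k^* )\right],\qquad \forall k\in\mathcal N^+,\ i\in\mathbb N,$$ where $\mathcal N^+$ is the set of normal agents.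
   Context: Setting. A network of $n$ agents is modeled by an undirected graph $\mathcal G=(\mathcal V,\mathcal E)$ with $(k,k)\in\mathcal E$ for all $k\in\mathcal V$; the neighborhood of $k$ is $\mathcal N_k=\{l\in\mathcal V:(l,k)\in\mathcal E\}$, so $k\in\mathcal N_k$. Agent $k$ has data sampled randomly from the distribution generated by a random variable $\xi_k$, a convex loss function $\ell(\theta_k;\xi_k)$ associated with a prediction function parameterized by $\theta_k\in\mathbb R^{d}$, and the expected risk function $r_k(\theta_k)=\mathbb E[\ell(\theta_k;\xi_k)]$; $\theta_k^*$ denotes the global minimum (minimizer) of the convex function $r_k$. For a model $\hat\theta_{l,i}$ of another agent, $r_k(\hat\theta_{l,i})=\mathbb E[\ell(\hat\theta_{l,i};\xi_k)]$. $\|\cdot\|$ is the Euclidean norm and $\mathbb E$ denotes expected value; in the conclusion it is taken with respect to the joint distribution of the random variables $\xi_k$ and $\xi_l$ for $l\in\mathcal N_k^{\le}$. Normal and Byzantine agents. Agents are either normal (they follow the algorithm) or Byzantine. Byzantine agents can send arbitrary, different information to different neighbors. For $l\in\mathcal N_k$, $\hat\theta_{l,i}$ denotes the model of $l$ used by $k$ at iteration $i$; it is arbitrary if $l$ is Byzantine. ATC diffusion algorithm. At each iteration $i$, a normal agent $k$ performs $$\hat\theta_{k,i}=\theta_{k,i-1}-\mu_k\nabla\ell(\theta_{k,i-1};\xi_k^{i-1})\quad\text{(adaptation)},\qquad \theta_{k,i}=\sum_{l\in\mathcal N_k}a_{lk}(i)\,\hat\theta_{l,i}\quad\text{(combination)},$$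 subject to $\sum_{l\in\mathcal N_k}a_{lk}(i)=1$, $a_{lk}(i)\ge0$, and $a_{lk}(i)=0$ if $l\notin\mathcal N_k$. Here $\mu_k$ is the step size, $a_{lk}(i)$ is the weight assigned by agent $k$ to agent $l$, and $\nabla\ell(\theta_{k,i-1};\xi_k^{i-1})$ is the gradient using the instantaneous realization $\xi_k^{i-1}$ of $\xi_k$. Assumption 1. For every normal agent $k$, the risk function $r_k$ is (differentiable and) $m$-strongly convex with $m>0$, i.e. $r_k(y)\ge r_k(x)+\langle\nabla r_k(x),y-x\rangle+\frac m2\|y-x\|^2$ for all $x,y$, and has $L$-Lipschitz continuous gradient with $L>0$, i.e. $\|\nabla r_k(x)-\nabla r_k(y)\|\le L\|x-y\|$ for all $x,y$. Assumption 2. For every normal agent $k$, the stochastic gradient $\nabla\ell(\theta_{k,i};\xi_k^i)$ is an unbiased estimate of $\nabla r_k(\theta_{k,i})$, i.e. $\mathbb E[\nabla\ell(\theta_{k,i};\xi_k^i)]=\nabla r_k(\theta_{k,i})$ for all $i\in\mathbb N$. Assumption 3. For every normal agent $k$, there exists $c_k\ge1$ such that for all $i\in\mathbb N$, $\mathbb E[\|\nabla\ell(\theta_{k,i};\xi_k^i)\|^2]\le\sigma_k^2+c_k\|\nabla r_k(\theta_{k,i})\|^2$, where $\sigma_k^2$ is a constant associated with agent $k$.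
   Formalization: The limit is replaced by the limit superior, since an intermittently helpful Byzantine neighbor can make the limit fail to exist; the initial model is assumed to have finite second moment, so that the expectations are finite. *)

theory Defs
  imports "HOL-Analysis.Analysis" "HOL-Probability.Probability"
begin

definition agent_network :: "'v set \<Rightarrow> ('v \<times> 'v) set \<Rightarrow> bool" where
  "agent_network V E \<longleftrightarrow> finite V \<and> E \<subseteq> V \<times> V \<and> sym E \<and> refl_on V E"

definition neighborhood :: "'v set \<Rightarrow> ('v \<times> 'v) set \<Rightarrow> 'v \<Rightarrow> 'v set" where
  "neighborhood V E k = {l \<in> V. (l, k) \<in> E}"

text \<open>Only meaningful at points where \<open>f\<close> is differentiable.\<close>

definition gradient :: "('a::real_inner \<Rightarrow> real) \<Rightarrow> 'a \<Rightarrow> 'a" where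
  "gradient f x = (THE D. GDERIV f x :> D)"

definition strongly_convex :: "real \<Rightarrow> ('a::real_inner \<Rightarrow> real) \<Rightarrow> bool" where
  "strongly_convex m f \<longleftrightarrow>
     (\<forall>x y. f y \<ge> f x + inner (gradient f x) (y - x) + m / 2 * (norm (y - x))\<^sup>2)"

definition expected_risk :: "'w measure \<Rightarrow> ('a \<Rightarrow> 'x \<Rightarrow> real) \<Rightarrow> ('w \<Rightarrow> 'x) \<Rightarrow> 'a \<Rightarrow> real" where
  "expected_risk M l \<xi> \<theta> = (\<integral>\<omega>. l \<theta> (\<xi> \<omega>) \<partial>M)"

text \<open>The data of one agent: the random variable \<open>\<xi>\<close> with values in \<open>S\<close>, its realizations
  \<open>X 0, X 1, \<dots>\<close> (random variables with the distribution of \<open>\<xi>\<close>), and a convex loss, differentiable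
  in the parameter, whose expectation exists at every parameter.\<close>

definition data_model ::
  "'w measure \<Rightarrow> 'x measure \<Rightarrow> ('a::real_inner \<Rightarrow> 'x \<Rightarrow> real) \<Rightarrow> ('w \<Rightarrow> 'x) \<Rightarrow> (nat \<Rightarrow> 'w \<Rightarrow> 'x) \<Rightarrow> bool" where
  "data_model M S l \<xi> X \<longleftrightarrow>
     \<xi> \<in> measurable M S \<and>
     (\<forall>i. X i \<in> measurable M S \<and> distr M S (X i) = distr M S \<xi>) \<and>
     (\<forall>x \<in> space S. convex_on UNIV (\<lambda>\<theta>. l \<theta> x) \<and> (\<forall>\<theta>. \<exists>D. GDERIV (\<lambda>\<phi>. l \<phi> x) \<theta> :> D)) \<and>
     (\<forall>\<theta>. integrable M (\<lambda>\<omega>. l \<theta> (\<xi> \<omega>)))"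

definition stochastic_gradient ::
  "('a::real_inner \<Rightarrow> 'x \<Rightarrow> real) \<Rightarrow> (nat \<Rightarrow> 'w \<Rightarrow> 'x) \<Rightarrow> (nat \<Rightarrow> 'w \<Rightarrow> 'a) \<Rightarrow> nat \<Rightarrow> 'w \<Rightarrow> 'a" where
  "stochastic_gradient l X \<theta> i \<omega> = gradient (\<lambda>\<phi>. l \<phi> (X i \<omega>)) (\<theta> i \<omega>)"

definition generated_sigma :: "'w measure \<Rightarrow> ('w \<Rightarrow> 'a::topological_space) \<Rightarrow> 'w measure" where
  "generated_sigma M Y = vimage_algebra (space M) Y borel"

definition smooth_strongly_convex_risk :: "real \<Rightarrow> real \<Rightarrow> ('a::real_inner \<Rightarrow> real) \<Rightarrow> bool" where
  "smooth_strongly_convex_risk m L r \<longleftrightarrow>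
     (\<forall>x. \<exists>D. GDERIV r x :> D) \<and> strongly_convex m r \<and> lipschitz_on L UNIV (gradient r)"

text \<open>The iterate \<open>\<theta> i\<close> is itself random, and the risk gradient is evaluated at it. The expectation
  of the stochastic gradient \<open>g i\<close> is therefore the conditional one given \<open>\<theta> i\<close>; it is taken
  componentwise. For samples \<open>X i\<close> that are independent of \<open>\<theta> i\<close>, this amounts to averaging over the
  sample with the parameter held at the value of \<open>\<theta> i\<close>.\<close>

definition unbiased_gradients ::
  "'w measure \<Rightarrow> (real^'d \<Rightarrow> real) \<Rightarrow> (nat \<Rightarrow> 'w \<Rightarrow> real^'d) \<Rightarrow> (nat \<Rightarrow> 'w \<Rightarrow> real^'d) \<Rightarrow> bool" where
  "unbiased_gradients M r \<theta> g \<longleftrightarrow>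
     (\<forall>i. g i \<in> borel_measurable M \<and>
        (\<forall>j. AE \<omega> in M. real_cond_exp M (generated_sigma M (\<theta> i)) (\<lambda>\<omega>. g i \<omega> $ j) \<omega>
                          = gradient r (\<theta> i \<omega>) $ j))"

text \<open>The \<open>ennreal\<close>-valued conditional expectation makes the bound include finiteness of the
  conditional second moment.\<close>

definition gradient_noise_bound ::
  "'w measure \<Rightarrow> real \<Rightarrow> real \<Rightarrow> (real^'d \<Rightarrow> real) \<Rightarrow> (nat \<Rightarrow> 'w \<Rightarrow> real^'d) \<Rightarrow> (nat \<Rightarrow> 'w \<Rightarrow> real^'d) \<Rightarrow> bool" where
  "gradient_noise_bound M \<sigma> c r \<theta> g \<longleftrightarrow>
     (\<forall>i. AE \<omega> in M.
        nn_cond_exp M (generated_sigma M (\<theta> i)) (\<lambda>\<omega>. ennreal ((norm (g i \<omega>))\<^sup>2)) \<omega>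
          \<le> ennreal (\<sigma>\<^sup>2 + c * (norm (gradient r (\<theta> i \<omega>)))\<^sup>2))"

text \<open>One agent \<open>k\<close> with neighborhood \<open>Nk\<close> running adapt-then-combine. \<open>h l i\<close> is the intermediate
  model of \<open>l\<close> used by \<open>k\<close> at iteration \<open>i\<close>, and \<open>a l i\<close> is the weight assigned to \<open>l\<close>, which may
  depend on the received models. \<open>\<theta> 0\<close> is the initial model, so \<open>h\<close> and \<open>a\<close> matter only from
  iteration 1 on.\<close>

definition atc_diffusion ::
  "'w measure \<Rightarrow> 'v set \<Rightarrow> 'v \<Rightarrow> real \<Rightarrow> (nat \<Rightarrow> 'w \<Rightarrow> 'a::real_vector) \<Rightarrow> (nat \<Rightarrow> 'w \<Rightarrow> 'a)
     \<Rightarrow> ('v \<Rightarrow> nat \<Rightarrow> 'w \<Rightarrow> 'a) \<Rightarrow> ('v \<Rightarrow> nat \<Rightarrow> 'w \<Rightarrow> real) \<Rightarrow> bool" where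
  "atc_diffusion M Nk k \<mu> \<theta> g h a \<longleftrightarrow>
     (\<forall>i. \<forall>\<omega> \<in> space M.
        h k (Suc i) \<omega> = \<theta> i \<omega> - \<mu> *\<^sub>R g i \<omega> \<and>
        \<theta> (Suc i) \<omega> = (\<Sum>l\<in>Nk. a l (Suc i) \<omega> *\<^sub>R h l (Suc i) \<omega>) \<and>
        (\<Sum>l\<in>Nk. a l (Suc i) \<omega>) = 1 \<and>
        (\<forall>l. a l (Suc i) \<omega> \<ge> 0) \<and>
        (\<forall>l. l \<notin> Nk \<longrightarrow> a l (Suc i) \<omega> = 0))"

definition le_neighbors :: "'v set \<Rightarrow> 'v \<Rightarrow> ('a \<Rightarrow> real) \<Rightarrow> ('v \<Rightarrow> 'a) \<Rightarrow> 'v set" where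
  "le_neighbors Nk k r h = {l \<in> Nk. r (h l) \<le> r (h k)}"

text \<open>The formula presupposes nonvanishing losses and denominator. With \<open>1 / 0 = 0\<close> a vanishing
  denominator gives all weights \<open>0\<close>, contradicting the constraint in \<open>atc_diffusion\<close> that they sum
  to 1; a neighbor with loss exactly \<open>0\<close> gets weight \<open>0\<close>.\<close>

definition loss_based_weight :: "'v set \<Rightarrow> 'v \<Rightarrow> ('a \<Rightarrow> real) \<Rightarrow> ('v \<Rightarrow> 'a) \<Rightarrow> 'v \<Rightarrow> real" where
  "loss_based_weight Nk k r h l =
     (if r (h l) \<le> r (h k)
      then inverse (r (h l)) / (\<Sum>p\<in>le_neighbors Nk k r h. inverse (r (h p)))
      else 0)"

definition uses_loss_based_weights ::
  "'w measure \<Rightarrow> 'v set \<Rightarrow> 'v \<Rightarrow> ('a \<Rightarrow> real) \<Rightarrow> ('v \<Rightarrow> nat \<Rightarrow> 'w \<Rightarrow> 'a)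
     \<Rightarrow> ('v \<Rightarrow> nat \<Rightarrow> 'w \<Rightarrow> real) \<Rightarrow> bool" where
  "uses_loss_based_weights M Nk k r h a \<longleftrightarrow>
     (\<forall>i. \<forall>\<omega> \<in> space M. \<forall>l \<in> Nk.
        a l (Suc i) \<omega> = loss_based_weight Nk k r (\<lambda>p. h p (Suc i) \<omega>) l)"

end

theory Submission
  imports Defs
begin

text \<open>The loss-based weights form a convex combination supported on neighbors whose model is no
  worse for agent \<open>k\<close> than its own adapted model. By convexity of the risk, the combination step
  therefore never increases the risk pathwise, whatever the Byzantine neighbors send, and the
  adaptation step is an ordinary stochastic gradient step: the descent lemma, the conditional moments
  of the stochastic gradient and the Polyak-Lojasiewicz inequality contract the expected
  excess risk by \<open>1 - \<mu> m\<close> up to an additive error \<open>\<mu>\<^sup>2 L \<sigma>\<^sup>2 / 2\<close>.\<close>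

section \<open>Gradients as definite descriptions\<close>

lemma GDERIV_unique:
  assumes "GDERIV f x :> D" "GDERIV f x :> D'"
  shows "D = D'"
proof -
  have "(\<lambda>h. inner h D) = (\<lambda>h. inner h D')"
    using assms unfolding gderiv_def by (rule has_derivative_unique)
  \<comment> \<open>Testing both functionals on \<open>D - D'\<close> leaves its squared norm equal
    to 0.\<close>
  then have "inner (D - D') D = inner (D - D') D'" by meson
  then have "inner (D - D') (D - D') = 0" by (simp add: inner_diff_right)
  then show ?thesis by simp
qed

lemma gradient_eqI: "GDERIV f x :> D \<Longrightarrow> gradient f x = D"
  unfolding gradient_def using GDERIV_unique by blast

section \<open>Smooth strongly convex functions with a minimizer\<close>

locale smooth_strongly_convex_minimum =
  fixes m L :: real and f :: "'a::real_inner \<Rightarrow> real" and x\<^sub>0 :: 'a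
  assumes m_pos: "m > 0" and L_pos: "L > 0"
    and smooth_strongly_convex: "smooth_strongly_convex_risk m L f"
    and minimum: "is_arg_min f (\<lambda>_. True) x\<^sub>0"
begin

lemma GDERIV_gradient: "GDERIV f x :> gradient f x"
  using smooth_strongly_convex gradient_eqI
  unfolding smooth_strongly_convex_risk_def by metis

lemma continuous: "continuous_on UNIV f"
  using GDERIV_gradient has_derivative_continuous
  unfolding gderiv_def continuous_on_eq_continuous_at[OF open_UNIV] by blast

lemma gradient_Lipschitz: "norm (gradient f x - gradient f y) \<le> L * norm (x - y)"
  using smooth_strongly_convex lipschitz_onD[of L UNIV "gradient f" x y]
  unfolding smooth_strongly_convex_risk_def by (simp add: dist_norm)

lemma continuous_gradient: "continuous_on UNIV (gradient f)"
  using smooth_strongly_convex lipschitz_on_continuous_on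
  unfolding smooth_strongly_convex_risk_def by blast

lemma strong_convexity:
  "f x + inner (gradient f x) (y - x) + m / 2 * (norm (y - x))\<^sup>2 \<le> f y"
  using smooth_strongly_convex
  unfolding smooth_strongly_convex_risk_def strongly_convex_def by blast

lemma minimum_le: "f x\<^sub>0 \<le> f x"
  using minimum unfolding is_arg_min_def by (meson linorder_not_le)

lemma descent: "f y \<le> f x + inner (gradient f x) (y - x) + L / 2 * (norm (y - x))\<^sup>2"
proof -
  define d where "d = y - x"
  \<comment> \<open>\<open>p\<close> is \<open>f\<close> along the segment minus the non-constant
    part of its quadratic upper model, so the claim is \<open>p 1 \<le> p 0\<close>. Cauchy-Schwarz
    and the Lipschitz gradient make its derivative nonpositive.\<close>
  define p where "p t = f (x + t *\<^sub>R d) - t * inner (gradient f x) d - L * (norm d)\<^sup>2 / 2 * t\<^sup>2"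
    for t :: real
  have "p 0 \<ge> p 1"
  proof (rule DERIV_nonpos_imp_nonincreasing[of 0 1 p])
    fix t :: real assume t: "0 \<le> t" "t \<le> 1"
    have "((\<lambda>t. f (x + t *\<^sub>R d)) has_derivative
            (\<lambda>h. inner (h *\<^sub>R d) (gradient f (x + t *\<^sub>R d)))) (at t)"
    proof (rule has_derivative_compose[of "\<lambda>t. x + t *\<^sub>R d" "\<lambda>h. h *\<^sub>R d"])
      show "((\<lambda>t. x + t *\<^sub>R d) has_derivative (\<lambda>h. h *\<^sub>R d)) (at t)"
        by (auto intro!: derivative_eq_intros)
      show "(f has_derivative (\<lambda>h. inner h (gradient f (x + t *\<^sub>R d)))) (at (x + t *\<^sub>R d))"
        using GDERIV_gradient unfolding gderiv_def .
    qed
    then have "DERIV (\<lambda>t. f (x + t *\<^sub>R d)) t :> inner (gradient f (x + t *\<^sub>R d)) d"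
      by (simp add: has_field_derivative_def inner_commute mult.commute[of _ "inner _ _"])
    then have D: "DERIV p t :> inner (gradient f (x + t *\<^sub>R d)) d - inner (gradient f x) d
                                - L * (norm d)\<^sup>2 * t"
      unfolding p_def by (auto intro!: derivative_eq_intros)
    have "inner (gradient f (x + t *\<^sub>R d) - gradient f x) d
            \<le> norm (gradient f (x + t *\<^sub>R d) - gradient f x) * norm d"
      by (rule norm_cauchy_schwarz)
    also have "\<dots> \<le> (L * norm (t *\<^sub>R d)) * norm d"
      using gradient_Lipschitz[of "x + t *\<^sub>R d" x] by (intro mult_right_mono) auto
    also have "\<dots> = L * (norm d)\<^sup>2 * t"
      using t by (simp add: power2_eq_square)
    finally show "\<exists>D. DERIV p t :> D \<and> D \<le> 0"
      using D by (intro exI[of _ "inner (gradient f (x + t *\<^sub>R d)) d - inner (gradient f x) d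
                                - L * (norm d)\<^sup>2 * t"]) (simp add: inner_diff_left)
  qed simp
  then show ?thesis by (simp add: p_def d_def)
qed

lemma gradient_step:
  "f (x - \<mu> *\<^sub>R v) \<le> f x - \<mu> * inner (gradient f x) v + L * \<mu>\<^sup>2 / 2 * (norm v)\<^sup>2"
  using descent[of "x - \<mu> *\<^sub>R v" x] by (simp add: power_mult_distrib)

text \<open>A gradient step of length \<open>1 / L\<close> from the minimizer would lower the value
  by at least the squared gradient norm over \<open>2 * L\<close>, which minimality forbids for a
  nonzero gradient.\<close>

lemma gradient_minimum: "gradient f x\<^sub>0 = 0"
proof -
  let ?G = "gradient f x\<^sub>0"
  have "f x\<^sub>0 \<le> f x\<^sub>0 - 1 / L * (norm ?G)\<^sup>2 + L * (1 / L)\<^sup>2 / 2 * (norm ?G)\<^sup>2"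
    using minimum_le[of "x\<^sub>0 - (1 / L) *\<^sub>R ?G"] gradient_step[of x\<^sub>0 "1 / L" ?G]
    by (simp add: power2_norm_eq_inner)
  also have "\<dots> = f x\<^sub>0 - (norm ?G)\<^sup>2 / (2 * L)"
    using L_pos by (simp add: field_simps power2_eq_square)
  finally have "(norm ?G)\<^sup>2 / (2 * L) \<le> 0" by simp
  then have "(norm ?G)\<^sup>2 \<le> 0" using L_pos by (simp add: divide_le_0_iff)
  then show ?thesis by simp
qed

lemma norm_gradient_le: "norm (gradient f x) \<le> L * norm (x - x\<^sub>0)"
  using gradient_Lipschitz[of x x\<^sub>0] by (simp add: gradient_minimum)

text \<open>Together with \<open>excess_lower\<close>, this makes the excess over the minimum
  comparable to the squared distance from the minimizer, so integrability passes between the two in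
  both directions.\<close>

lemma excess_upper: "f x - f x\<^sub>0 \<le> L / 2 * (norm (x - x\<^sub>0))\<^sup>2"
  using descent[of x x\<^sub>0] by (simp add: gradient_minimum)

lemma excess_lower: "m / 2 * (norm (x - x\<^sub>0))\<^sup>2 \<le> f x - f x\<^sub>0"
  using strong_convexity[of x\<^sub>0 x] by (simp add: gradient_minimum)

text \<open>Completing the square: in the expansion of the squared norm of
  \<open>gradient f x + m *\<^sub>R (x\<^sub>0 - x)\<close>, the terms beside the squared gradient
  are \<open>2 * m\<close> times the correction that strong convexity bounds by
  \<open>f x\<^sub>0 - f x\<close>.\<close>

lemma Polyak_Lojasiewicz: "2 * m * (f x - f x\<^sub>0) \<le> (norm (gradient f x))\<^sup>2"
proof -
  have "0 \<le> (norm (gradient f x + m *\<^sub>R (x\<^sub>0 - x)))\<^sup>2" by simp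
  also have "\<dots> = (norm (gradient f x))\<^sup>2
      + 2 * m * (inner (gradient f x) (x\<^sub>0 - x) + m / 2 * (norm (x\<^sub>0 - x))\<^sup>2)"
    unfolding power2_norm_eq_inner inner_add_left inner_add_right inner_scaleR_left inner_scaleR_right
    by (simp add: algebra_simps inner_commute)
  also have "\<dots> \<le> (norm (gradient f x))\<^sup>2 + 2 * m * (f x\<^sub>0 - f x)"
    using strong_convexity[of x x\<^sub>0] m_pos by (intro add_left_mono mult_left_mono) auto
  finally show ?thesis by (simp add: algebra_simps)
qed

text \<open>Away from the minimizer the two quadratic bounds on the excess can be compared. This
  later keeps the contraction factor nonnegative.\<close>

lemma strong_convexity_le_Lipschitz:
  assumes "x \<noteq> x\<^sub>0"
  shows "m \<le> L"
proof -
  have "m / 2 * (norm (x - x\<^sub>0))\<^sup>2 \<le> L / 2 * (norm (x - x\<^sub>0))\<^sup>2"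
    using excess_lower excess_upper by (rule order_trans)
  then show ?thesis using assms by simp
qed

text \<open>Jensen's inequality through the tangent at the mean \<open>z\<close>: the tangent lies
  below \<open>f\<close>, and its linear parts cancel in the average. The bound is asked only of
  points with nonzero weight, so discarded points may be arbitrary.\<close>

lemma convex_combination_le:
  assumes "finite I" and w: "\<And>i. i \<in> I \<Longrightarrow> w i \<ge> 0" "sum w I = 1"
    and le: "\<And>i. i \<in> I \<Longrightarrow> w i \<noteq> 0 \<Longrightarrow> f (y i) \<le> b"
  shows "f (\<Sum>i\<in>I. w i *\<^sub>R y i) \<le> b"
proof -
  define z where "z = (\<Sum>i\<in>I. w i *\<^sub>R y i)"
  have "(\<Sum>i\<in>I. w i *\<^sub>R (y i - z)) = z - sum w I *\<^sub>R z"
    by (simp add: z_def scaleR_diff_right sum_subtractf scaleR_left.sum)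
  then have mean: "(\<Sum>i\<in>I. w i *\<^sub>R (y i - z)) = 0"
    using w(2) by simp
  have "f z = (\<Sum>i\<in>I. w i * f z) + inner (gradient f z) (\<Sum>i\<in>I. w i *\<^sub>R (y i - z))"
    by (simp add: mean w(2) flip: sum_distrib_right)
  also have "\<dots> = (\<Sum>i\<in>I. w i * (f z + inner (gradient f z) (y i - z)))"
    by (simp add: inner_sum_right sum.distrib distrib_left)
  also have "\<dots> \<le> (\<Sum>i\<in>I. w i * b)"
  proof (rule sum_mono)
    fix i assume i: "i \<in> I"
    show "w i * (f z + inner (gradient f z) (y i - z)) \<le> w i * b"
    proof (cases "w i = 0")
      case False
      have "0 \<le> m / 2 * (norm (y i - z))\<^sup>2" using m_pos by simp
      then have "f z + inner (gradient f z) (y i - z) \<le> b"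
        using strong_convexity[of z "y i"] le[OF i False] by linarith
      then show ?thesis using w(1)[OF i] by (rule mult_left_mono)
    qed simp
  qed
  also have "\<dots> = b" by (simp add: w(2) flip: sum_distrib_right)
  finally show ?thesis by (simp add: z_def)
qed

end

section \<open>Contraction with an additive error\<close>

lemma limsup_affine_recurrence:
  fixes e :: "nat \<Rightarrow> real"
  assumes q: "0 \<le> q" "q < 1" and step: "\<And>i. e (Suc i) \<le> q * e i + b"
  shows "limsup (\<lambda>i. ereal (e i)) \<le> ereal (b / (1 - q))"
proof -
  \<comment> \<open>\<open>B\<close> is the fixed point of the map sending \<open>t\<close> to
    \<open>q * t + b\<close>, and the bound on the excess over \<open>B\<close> shrinks by the
    factor \<open>q\<close> at each step. As the recurrence is only an inequality, \<open>e\<close>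
    need not converge, which is why the limit superior is bounded.\<close>
  define B where "B = b / (1 - q)"
  have B: "B = q * B + b" using q by (simp add: B_def field_simps)
  have "e i \<le> q ^ i * (e 0 - B) + B" for i
  proof (induction i)
    case (Suc i)
    have "e (Suc i) \<le> q * (q ^ i * (e 0 - B) + B) + b"
      using step[of i] mult_left_mono[OF Suc q(1)] by linarith
    also have "\<dots> = q ^ Suc i * (e 0 - B) + (q * B + b)" by (simp add: algebra_simps)
    finally show ?case using B by simp
  qed simp
  then have "limsup (\<lambda>i. ereal (e i)) \<le> limsup (\<lambda>i. ereal (q ^ i * (e 0 - B) + B))"
    by (intro Limsup_mono) auto
  also have "(\<lambda>i. q ^ i * (e 0 - B) + B) \<longlonglongrightarrow> 0 * (e 0 - B) + B"
    using q by (intro tendsto_intros LIMSEQ_power_zero) auto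
  then have "limsup (\<lambda>i. ereal (q ^ i * (e 0 - B) + B)) = ereal B"
    by (intro lim_imp_Limsup) auto
  finally show ?thesis by (simp add: B_def)
qed

section \<open>Conditional expectations and square-integrable functions\<close>

lemma subalgebra_generated_sigma:
  "Y \<in> borel_measurable M \<Longrightarrow> subalgebra M (generated_sigma M Y)"
  unfolding subalgebra_def generated_sigma_def
  by (auto simp: sets_vimage_algebra2 measurable_space)

lemma measurable_generated_sigma: "Y \<in> borel_measurable (generated_sigma M Y)"
  unfolding generated_sigma_def by (rule measurable_vimage_algebra1) auto

text \<open>For nonnegative functions the tower property holds before integrability is known.
  Integrability of \<open>f\<close> is thus a consequence of the conditional bound.\<close>

lemma (in sigma_finite_subalgebra) integral_le_of_nn_cond_exp_le:
  assumes f: "f \<in> borel_measurable M" "\<And>x. 0 \<le> f x"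
    and b: "integrable M b" "\<And>x. 0 \<le> b x"
    and le: "AE x in M. nn_cond_exp M F (\<lambda>x. ennreal (f x)) x \<le> ennreal (b x)"
  shows "integrable M f" "(\<integral>x. f x \<partial>M) \<le> (\<integral>x. b x \<partial>M)"
proof -
  have "(\<integral>\<^sup>+x. ennreal (f x) \<partial>M) = (\<integral>\<^sup>+x. nn_cond_exp M F (\<lambda>x. ennreal (f x)) x \<partial>M)"
    using nn_cond_exp_intg[of "\<lambda>_. 1" "\<lambda>x. ennreal (f x)"] f by simp
  also have "\<dots> \<le> (\<integral>\<^sup>+x. ennreal (b x) \<partial>M)"
    using le by (rule nn_integral_mono_AE)
  also have "\<dots> = ennreal (\<integral>x. b x \<partial>M)"
    using b by (intro nn_integral_eq_integral) auto
  finally have le': "(\<integral>\<^sup>+x. ennreal (f x) \<partial>M) \<le> ennreal (\<integral>x. b x \<partial>M)" .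
  then show "integrable M f"
    using f by (intro integrableI_nonneg) (auto simp: less_top[symmetric] top_unique)
  then show "(\<integral>x. f x \<partial>M) \<le> (\<integral>x. b x \<partial>M)"
    using le' f b by (simp add: nn_integral_eq_integral integral_nonneg_AE)
qed

lemma integrable_mult_of_square_integrable:
  fixes u v :: "'w \<Rightarrow> real"
  assumes [measurable]: "u \<in> borel_measurable M" "v \<in> borel_measurable M"
    and "integrable M (\<lambda>x. (u x)\<^sup>2)" "integrable M (\<lambda>x. (v x)\<^sup>2)"
  shows "integrable M (\<lambda>x. u x * v x)"
proof (rule Bochner_Integration.integrable_bound)
  show "integrable M (\<lambda>x. (u x)\<^sup>2 + (v x)\<^sup>2)" using assms by simp
  show "AE x in M. norm (u x * v x) \<le> norm ((u x)\<^sup>2 + (v x)\<^sup>2)"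
  proof (rule AE_I2)
    fix x
    have "2 * \<bar>u x\<bar> * \<bar>v x\<bar> \<le> (u x)\<^sup>2 + (v x)\<^sup>2"
      using sum_squares_bound[of "\<bar>u x\<bar>" "\<bar>v x\<bar>"] by simp
    \<comment> \<open>The product of absolute values is nonnegative, so it is at most twice
      itself.\<close>
    then show "norm (u x * v x) \<le> norm ((u x)\<^sup>2 + (v x)\<^sup>2)"
      using mult_nonneg_nonneg[OF abs_ge_zero[of "u x"] abs_ge_zero[of "v x"]]
      by (simp only: real_norm_def abs_mult)
  qed
qed simp

lemma square_integrable_component:
  fixes u :: "'w \<Rightarrow> real^'d"
  assumes [measurable]: "u \<in> borel_measurable M" and "integrable M (\<lambda>x. (norm (u x))\<^sup>2)"
  shows "integrable M (\<lambda>x. (u x $ j)\<^sup>2)"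
proof (rule Bochner_Integration.integrable_bound[OF assms(2)])
  show "(\<lambda>x. (u x $ j)\<^sup>2) \<in> borel_measurable M"
    using borel_measurable_continuous_onI[of "\<lambda>v::real^'d. (v $ j)\<^sup>2"]
    by (intro measurable_compose[OF assms(1)]) (auto intro!: continuous_intros)
  show "AE x in M. norm ((u x $ j)\<^sup>2) \<le> norm ((norm (u x))\<^sup>2)"
    by (auto intro!: AE_I2 abs_le_square_iff[THEN iffD1] simp: component_le_norm_cart)
qed

lemma square_integrable_add:
  fixes u v :: "'w \<Rightarrow> 'a::{real_normed_vector, second_countable_topology}"
  assumes [measurable]: "u \<in> borel_measurable M" "v \<in> borel_measurable M"
    and "integrable M (\<lambda>x. (norm (u x))\<^sup>2)" "integrable M (\<lambda>x. (norm (v x))\<^sup>2)"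
  shows "integrable M (\<lambda>x. (norm (u x + v x))\<^sup>2)"
proof (rule Bochner_Integration.integrable_bound)
  show "integrable M (\<lambda>x. 2 * (norm (u x))\<^sup>2 + 2 * (norm (v x))\<^sup>2)" using assms by simp
  have "(norm (u x + v x))\<^sup>2 \<le> 2 * (norm (u x))\<^sup>2 + 2 * (norm (v x))\<^sup>2" for x
  proof -
    have "(norm (u x + v x))\<^sup>2 \<le> (norm (u x) + norm (v x))\<^sup>2"
      by (intro power_mono norm_triangle_ineq) auto
    also have "\<dots> \<le> 2 * (norm (u x))\<^sup>2 + 2 * (norm (v x))\<^sup>2"
      using sum_squares_bound[of "norm (u x)" "norm (v x)"] by (simp add: power2_sum)
    finally show ?thesis .
  qed
  then show "AE x in M. norm ((norm (u x + v x))\<^sup>2)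
      \<le> norm (2 * (norm (u x))\<^sup>2 + 2 * (norm (v x))\<^sup>2)"
    by (auto intro!: AE_I2)
qed simp

text \<open>Being measurable for \<open>F\<close>, \<open>u\<close> can be pulled out of the
  conditional expectation. This is done for each component and summed; square integrability makes
  the products integrable. \<open>w\<close> is any almost sure version of the conditional
  expectation of \<open>v\<close>.\<close>

lemma (in sigma_finite_subalgebra) integral_inner_cond_exp:
  fixes u v w :: "'a \<Rightarrow> real^'d"
  assumes u: "u \<in> borel_measurable F" and [measurable]: "v \<in> borel_measurable M"
    and sq: "integrable M (\<lambda>x. (norm (u x))\<^sup>2)" "integrable M (\<lambda>x. (norm (v x))\<^sup>2)"
    and w: "w \<in> borel_measurable M"
    and cond: "\<And>j. AE x in M. real_cond_exp M F (\<lambda>x. v x $ j) x = w x $ j"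
  shows "integrable M (\<lambda>x. inner (u x) (v x))"
    and "(\<integral>x. inner (u x) (v x) \<partial>M) = (\<integral>x. inner (u x) (w x) \<partial>M)"
proof -
  have nth: "(\<lambda>v::real^'d. v $ j) \<in> borel_measurable borel" for j
    by (intro borel_measurable_continuous_onI continuous_intros)
  have uM: "u \<in> borel_measurable M" using measurable_from_subalg[OF subalg u] .
  have [measurable]: "(\<lambda>x. u x $ j) \<in> borel_measurable F"
    "(\<lambda>x. u x $ j) \<in> borel_measurable M" "(\<lambda>x. v x $ j) \<in> borel_measurable M"
    "(\<lambda>x. w x $ j) \<in> borel_measurable M" for j
    using measurable_compose[OF u nth] measurable_compose[OF uM nth]
      measurable_compose[OF _ nth, of v M] measurable_compose[OF w nth] by auto
  have int: "integrable M (\<lambda>x. u x $ j * v x $ j)" for j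
    using sq uM by (intro integrable_mult_of_square_integrable square_integrable_component) auto
  have int': "integrable M (\<lambda>x. u x $ j * w x $ j)"
    and eq: "(\<integral>x. u x $ j * w x $ j \<partial>M) = (\<integral>x. u x $ j * v x $ j \<partial>M)" for j
  proof -
    have AE: "AE x in M. u x $ j * real_cond_exp M F (\<lambda>x. v x $ j) x = u x $ j * w x $ j"
      using cond[of j] by eventually_elim simp
    have "integrable M (\<lambda>x. u x $ j * real_cond_exp M F (\<lambda>x. v x $ j) x)"
      using int by (intro real_cond_exp_intg) auto
    then show "integrable M (\<lambda>x. u x $ j * w x $ j)"
      by (rule integrable_cong_AE_imp) (use AE in auto)
    have "(\<integral>x. u x $ j * w x $ j \<partial>M) = (\<integral>x. u x $ j * real_cond_exp M F (\<lambda>x. v x $ j) x \<partial>M)"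
      using AE by (intro integral_cong_AE) auto
    also have "\<dots> = (\<integral>x. u x $ j * v x $ j \<partial>M)"
      using int by (intro real_cond_exp_intg) auto
    finally show "(\<integral>x. u x $ j * w x $ j \<partial>M) = (\<integral>x. u x $ j * v x $ j \<partial>M)" .
  qed
  show "integrable M (\<lambda>x. inner (u x) (v x))"
    unfolding inner_vec_def using int by simp
  show "(\<integral>x. inner (u x) (v x) \<partial>M) = (\<integral>x. inner (u x) (w x) \<partial>M)"
    unfolding inner_vec_def using int int' eq by (simp add: Bochner_Integration.integral_sum)
qed

section \<open>One stochastic gradient step from a random iterate\<close>

locale noisy_gradient = prob_space M + smooth_strongly_convex_minimum m L f x\<^sub>0
  for M :: "'w measure" and m L :: real and f :: "real^'d \<Rightarrow> real" and x\<^sub>0 :: "real^'d" +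
  fixes \<theta> g :: "nat \<Rightarrow> 'w \<Rightarrow> real^'d" and \<sigma> c :: real
  assumes iterate_measurable [measurable]: "\<And>i. \<theta> i \<in> borel_measurable M"
    and unbiased: "unbiased_gradients M f \<theta> g"
    and noise: "gradient_noise_bound M \<sigma> c f \<theta> g"
    and c_ge_1: "c \<ge> 1"
begin

lemma gradient_measurable [measurable]: "gradient f \<in> borel_measurable borel"
  using continuous_gradient by (rule borel_measurable_continuous_onI)

lemma risk_measurable [measurable]: "f \<in> borel_measurable borel"
  using continuous by (rule borel_measurable_continuous_onI)

lemma noise_measurable [measurable]: "g i \<in> borel_measurable M"
  using unbiased unfolding unbiased_gradients_def by blast

lemma integrable_excess:
  assumes [measurable]: "Y \<in> borel_measurable M"
    and "integrable M (\<lambda>\<omega>. (norm (Y \<omega> - x\<^sub>0))\<^sup>2)"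
  shows "integrable M (\<lambda>\<omega>. f (Y \<omega>) - f x\<^sub>0)"
proof (rule Bochner_Integration.integrable_bound)
  show "integrable M (\<lambda>\<omega>. L / 2 * (norm (Y \<omega> - x\<^sub>0))\<^sup>2)" using assms by simp
  show "AE \<omega> in M. norm (f (Y \<omega>) - f x\<^sub>0) \<le> norm (L / 2 * (norm (Y \<omega> - x\<^sub>0))\<^sup>2)"
    using excess_upper minimum_le L_pos by (auto intro!: AE_I2)
qed simp

lemma square_integrable_dist:
  assumes [measurable]: "Y \<in> borel_measurable M"
    and "integrable M (\<lambda>\<omega>. f (Y \<omega>) - f x\<^sub>0)"
  shows "integrable M (\<lambda>\<omega>. (norm (Y \<omega> - x\<^sub>0))\<^sup>2)"
proof (rule Bochner_Integration.integrable_bound)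
  show "integrable M (\<lambda>\<omega>. 2 / m * (f (Y \<omega>) - f x\<^sub>0))"
    by (intro integrable_mult_right assms)
  show "AE \<omega> in M. norm ((norm (Y \<omega> - x\<^sub>0))\<^sup>2) \<le> norm (2 / m * (f (Y \<omega>) - f x\<^sub>0))"
  proof (rule AE_I2)
    fix \<omega>
    show "norm ((norm (Y \<omega> - x\<^sub>0))\<^sup>2) \<le> norm (2 / m * (f (Y \<omega>) - f x\<^sub>0))"
      using excess_lower[of "Y \<omega>"] minimum_le[of "Y \<omega>"] m_pos by (simp add: field_simps)
  qed
qed simp

text \<open>The step is studied at a single iterate with finite second moment about the minimizer.
  Successive iterates are not linked here, which leaves room for a combination step between
  them.\<close>

context
  fixes i :: nat
  assumes square_integrable: "integrable M (\<lambda>\<omega>. (norm (\<theta> i \<omega> - x\<^sub>0))\<^sup>2)"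
begin

interpretation finite_measure_subalgebra M "generated_sigma M (\<theta> i)"
  by unfold_locales (simp add: subalgebra_generated_sigma)

lemma square_integrable_gradient: "integrable M (\<lambda>\<omega>. (norm (gradient f (\<theta> i \<omega>)))\<^sup>2)"
proof (rule Bochner_Integration.integrable_bound)
  show "integrable M (\<lambda>\<omega>. L\<^sup>2 * (norm (\<theta> i \<omega> - x\<^sub>0))\<^sup>2)" using square_integrable by simp
  show "AE \<omega> in M. norm ((norm (gradient f (\<theta> i \<omega>)))\<^sup>2) \<le> norm (L\<^sup>2 * (norm (\<theta> i \<omega> - x\<^sub>0))\<^sup>2)"
    using norm_gradient_le power_mono[OF norm_gradient_le norm_ge_zero, of _ 2]
    by (auto intro!: AE_I2 simp: power_mult_distrib)
qed simp

lemma noise_second_moment: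
  shows "integrable M (\<lambda>\<omega>. (norm (g i \<omega>))\<^sup>2)"
    and "(\<integral>\<omega>. (norm (g i \<omega>))\<^sup>2 \<partial>M) \<le> \<sigma>\<^sup>2 + c * (\<integral>\<omega>. (norm (gradient f (\<theta> i \<omega>)))\<^sup>2 \<partial>M)"
proof -
  let ?b = "\<lambda>\<omega>. \<sigma>\<^sup>2 + c * (norm (gradient f (\<theta> i \<omega>)))\<^sup>2"
  have b: "integrable M ?b" "\<And>\<omega>. 0 \<le> ?b \<omega>"
    using square_integrable_gradient c_ge_1 by auto
  have AE: "AE \<omega> in M. nn_cond_exp M (generated_sigma M (\<theta> i)) (\<lambda>\<omega>. ennreal ((norm (g i \<omega>))\<^sup>2)) \<omega>
      \<le> ennreal (?b \<omega>)"
    using noise unfolding gradient_noise_bound_def by blast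
  show "integrable M (\<lambda>\<omega>. (norm (g i \<omega>))\<^sup>2)"
    by (rule integral_le_of_nn_cond_exp_le(1)[OF _ _ b AE]) auto
  have "(\<integral>\<omega>. (norm (g i \<omega>))\<^sup>2 \<partial>M) \<le> (\<integral>\<omega>. ?b \<omega> \<partial>M)"
    by (rule integral_le_of_nn_cond_exp_le(2)[OF _ _ b AE]) auto
  also have "\<dots> = \<sigma>\<^sup>2 + c * (\<integral>\<omega>. (norm (gradient f (\<theta> i \<omega>)))\<^sup>2 \<partial>M)"
    using square_integrable_gradient by (simp add: prob_space)
  finally show "(\<integral>\<omega>. (norm (g i \<omega>))\<^sup>2 \<partial>M)
      \<le> \<sigma>\<^sup>2 + c * (\<integral>\<omega>. (norm (gradient f (\<theta> i \<omega>)))\<^sup>2 \<partial>M)" .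
qed

text \<open>The risk gradient at the iterate is a function of that iterate, hence measurable for the
  conditioning sigma-algebra; unbiasedness then replaces the noisy gradient by the true one inside
  the inner product.\<close>

lemma inner_gradient_noise:
  shows "integrable M (\<lambda>\<omega>. inner (gradient f (\<theta> i \<omega>)) (g i \<omega>))"
    and "(\<integral>\<omega>. inner (gradient f (\<theta> i \<omega>)) (g i \<omega>) \<partial>M)
           = (\<integral>\<omega>. (norm (gradient f (\<theta> i \<omega>)))\<^sup>2 \<partial>M)"
proof -
  have u: "(\<lambda>\<omega>. gradient f (\<theta> i \<omega>)) \<in> borel_measurable (generated_sigma M (\<theta> i))"
    by (rule measurable_compose[OF measurable_generated_sigma gradient_measurable])
  have cond: "AE \<omega> in M. real_cond_exp M (generated_sigma M (\<theta> i)) (\<lambda>\<omega>. g i \<omega> $ j) \<omega>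
      = gradient f (\<theta> i \<omega>) $ j" for j
    using unbiased unfolding unbiased_gradients_def by blast
  note * = integral_inner_cond_exp[OF u noise_measurable square_integrable_gradient
      noise_second_moment(1) _ cond]
  show "integrable M (\<lambda>\<omega>. inner (gradient f (\<theta> i \<omega>)) (g i \<omega>))"
    by (rule *(1)) simp
  show "(\<integral>\<omega>. inner (gradient f (\<theta> i \<omega>)) (g i \<omega>) \<partial>M)
      = (\<integral>\<omega>. (norm (gradient f (\<theta> i \<omega>)))\<^sup>2 \<partial>M)"
    unfolding power2_norm_eq_inner by (rule *(2)) simp
qed

text \<open>This holds for every step size: only finiteness of the second moments of the iterate and
  of the noisy gradient matters.\<close>

lemma integrable_excess_step: "integrable M (\<lambda>\<omega>. f (\<theta> i \<omega> - \<mu> *\<^sub>R g i \<omega>) - f x\<^sub>0)"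
proof (rule integrable_excess)
  have "integrable M (\<lambda>\<omega>. (norm ((\<theta> i \<omega> - x\<^sub>0) + (- \<mu>) *\<^sub>R g i \<omega>))\<^sup>2)"
    using square_integrable noise_second_moment(1)
    by (intro square_integrable_add) (auto simp: power_mult_distrib)
  then show "integrable M (\<lambda>\<omega>. (norm (\<theta> i \<omega> - \<mu> *\<^sub>R g i \<omega> - x\<^sub>0))\<^sup>2)"
    by (simp add: algebra_simps)
qed simp

lemma expected_excess_step:
  assumes \<mu>: "0 < \<mu>" "\<mu> \<le> 1 / (L * c)"
  shows "(\<integral>\<omega>. (f (\<theta> i \<omega> - \<mu> *\<^sub>R g i \<omega>) - f x\<^sub>0) \<partial>M)
    \<le> (1 - \<mu> * m) * (\<integral>\<omega>. (f (\<theta> i \<omega>) - f x\<^sub>0) \<partial>M) + L * \<mu>\<^sup>2 / 2 * \<sigma>\<^sup>2"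
proof -
  define G where "G = (\<integral>\<omega>. (norm (gradient f (\<theta> i \<omega>)))\<^sup>2 \<partial>M)"
  define e where "e = (\<integral>\<omega>. (f (\<theta> i \<omega>) - f x\<^sub>0) \<partial>M)"
  have int: "integrable M (\<lambda>\<omega>. f (\<theta> i \<omega>) - f x\<^sub>0)"
    using square_integrable by (intro integrable_excess) auto
  note ints = int inner_gradient_noise(1) noise_second_moment(1)
  have "(\<integral>\<omega>. (f (\<theta> i \<omega> - \<mu> *\<^sub>R g i \<omega>) - f x\<^sub>0) \<partial>M)
      \<le> (\<integral>\<omega>. ((f (\<theta> i \<omega>) - f x\<^sub>0) - \<mu> * inner (gradient f (\<theta> i \<omega>)) (g i \<omega>)
             + L * \<mu>\<^sup>2 / 2 * (norm (g i \<omega>))\<^sup>2) \<partial>M)"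
  proof (rule integral_mono)
    show "integrable M (\<lambda>\<omega>. f (\<theta> i \<omega> - \<mu> *\<^sub>R g i \<omega>) - f x\<^sub>0)"
      by (rule integrable_excess_step)
    show "integrable M (\<lambda>\<omega>. (f (\<theta> i \<omega>) - f x\<^sub>0) - \<mu> * inner (gradient f (\<theta> i \<omega>)) (g i \<omega>)
             + L * \<mu>\<^sup>2 / 2 * (norm (g i \<omega>))\<^sup>2)"
      by (intro Bochner_Integration.integrable_add integrable_mult_right ints
          Bochner_Integration.integrable_diff[OF int])
    show "f (\<theta> i \<omega> - \<mu> *\<^sub>R g i \<omega>) - f x\<^sub>0
        \<le> (f (\<theta> i \<omega>) - f x\<^sub>0) - \<mu> * inner (gradient f (\<theta> i \<omega>)) (g i \<omega>)
             + L * \<mu>\<^sup>2 / 2 * (norm (g i \<omega>))\<^sup>2" for \<omega>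
      using gradient_step[of "\<theta> i \<omega>" \<mu> "g i \<omega>"] by simp
  qed
  also have "\<dots> = e - \<mu> * G + L * \<mu>\<^sup>2 / 2 * (\<integral>\<omega>. (norm (g i \<omega>))\<^sup>2 \<partial>M)"
    using ints by (simp add: e_def G_def inner_gradient_noise(2)
        Bochner_Integration.integral_add[OF Bochner_Integration.integrable_diff]
        Bochner_Integration.integral_diff del: Bochner_Integration.integral_minus)
  also have "\<dots> \<le> e - \<mu> * G + L * \<mu>\<^sup>2 / 2 * (\<sigma>\<^sup>2 + c * G)"
    using noise_second_moment(2) L_pos unfolding G_def
    by (intro add_left_mono mult_left_mono) auto
  also have "\<dots> = e - \<mu> / 2 * (2 - \<mu> * (L * c)) * G + L * \<mu>\<^sup>2 / 2 * \<sigma>\<^sup>2"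
    by (simp add: field_simps power2_eq_square)
  \<comment> \<open>The step size bound makes \<open>2 - \<mu> * (L * c)\<close> at least 1, and the
    integrated Polyak-Lojasiewicz inequality bounds \<open>G\<close> below by
    \<open>2 * m * e\<close>. Since \<open>e\<close> is nonnegative, the two bounds may be
    multiplied.\<close>
  also have "\<dots> \<le> e - \<mu> / 2 * 1 * (2 * m * e) + L * \<mu>\<^sup>2 / 2 * \<sigma>\<^sup>2"
  proof -
    have "(\<integral>\<omega>. 2 * m * (f (\<theta> i \<omega>) - f x\<^sub>0) \<partial>M) \<le> G"
      unfolding G_def using int square_integrable_gradient
      by (intro integral_mono Polyak_Lojasiewicz) auto
    then have PL: "2 * m * e \<le> G" by (simp add: e_def)
    have "0 \<le> e"
      unfolding e_def using minimum_le by (intro integral_nonneg_AE) auto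
    moreover have "\<mu> * (L * c) \<le> 1"
      using \<mu>(2) L_pos c_ge_1 by (simp add: pos_le_divide_eq)
    ultimately have "\<mu> / 2 * 1 * (2 * m * e) \<le> \<mu> / 2 * (2 - \<mu> * (L * c)) * G"
      using PL \<mu>(1) m_pos by (intro mult_mono) auto
    then show ?thesis by linarith
  qed
  also have "\<dots> = (1 - \<mu> * m) * e + L * \<mu>\<^sup>2 / 2 * \<sigma>\<^sup>2"
    by (simp add: algebra_simps)
  finally show ?thesis unfolding e_def .
qed

end

end

section \<open>The combination step and convergence of the diffusion iterates\<close>

lemma loss_based_combination_le:
  assumes "smooth_strongly_convex_minimum m L r x\<^sub>0" and "finite Nk" and "\<omega> \<in> space M"
    and "atc_diffusion M Nk k \<mu> \<theta> g h a" and "uses_loss_based_weights M Nk k r h a"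
  shows "r (\<theta> (Suc i) \<omega>) \<le> r (h k (Suc i) \<omega>)"
proof -
  interpret smooth_strongly_convex_minimum m L r x\<^sub>0 by fact
  have \<theta>: "\<theta> (Suc i) \<omega> = (\<Sum>l\<in>Nk. a l (Suc i) \<omega> *\<^sub>R h l (Suc i) \<omega>)"
    and w: "(\<Sum>l\<in>Nk. a l (Suc i) \<omega>) = 1" "\<And>l. a l (Suc i) \<omega> \<ge> 0"
    using assms(3,4) unfolding atc_diffusion_def by auto
  \<comment> \<open>A nonzero weight can only come from the first branch of the definition, whose
    condition is this inequality. A neighbor of risk 0 is covered as well: its weight is 0 because
    \<open>inverse 0 = 0\<close>.\<close>
  have le: "r (h l (Suc i) \<omega>) \<le> r (h k (Suc i) \<omega>)" if "l \<in> Nk" "a l (Suc i) \<omega> \<noteq> 0" for l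
    using assms(3,5) that unfolding uses_loss_based_weights_def loss_based_weight_def by metis
  show ?thesis
    unfolding \<theta> by (rule convex_combination_le[OF assms(2) w(2) w(1) le])
qed

theorem theorem1:
  fixes M :: "'w measure"
    and V Normal :: "'v set" and E :: "('v \<times> 'v) set"
    and S :: "'v \<Rightarrow> 'x measure"
    and loss :: "'v \<Rightarrow> real^'d \<Rightarrow> 'x \<Rightarrow> real"
    and \<xi> :: "'v \<Rightarrow> 'w \<Rightarrow> 'x" and X :: "'v \<Rightarrow> nat \<Rightarrow> 'w \<Rightarrow> 'x"
    and r :: "'v \<Rightarrow> real^'d \<Rightarrow> real" and \<theta>star :: "'v \<Rightarrow> real^'d"
    and \<theta> :: "'v \<Rightarrow> nat \<Rightarrow> 'w \<Rightarrow> real^'d"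
    and \<theta>hat :: "'v \<Rightarrow> 'v \<Rightarrow> nat \<Rightarrow> 'w \<Rightarrow> real^'d" (* \<theta>hat k l i: model of l used by k *)
    and g :: "'v \<Rightarrow> nat \<Rightarrow> 'w \<Rightarrow> real^'d"
    and a :: "'v \<Rightarrow> 'v \<Rightarrow> nat \<Rightarrow> 'w \<Rightarrow> real" (* a l k i: weight assigned by k to l *)
    and \<mu> \<sigma> c :: "'v \<Rightarrow> real" and m L :: real
  assumes prob: "prob_space M"
    and network: "agent_network V E"
    and normal: "Normal \<subseteq> V"
    and data: "\<forall>k\<in>Normal. data_model M (S k) (loss k) (\<xi> k) (X k)"
    and risk: "\<forall>k. r k = expected_risk M (loss k) (\<xi> k)"
    and minimizer: "\<forall>k\<in>Normal. is_arg_min (r k) (\<lambda>_. True) (\<theta>star k)"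
    and grad: "\<forall>k. g k = stochastic_gradient (loss k) (X k) (\<theta> k)"
    and models_rv: "\<forall>k\<in>Normal. \<forall>i. \<theta> k i \<in> borel_measurable M"
    and received_rv: "\<forall>k\<in>Normal. \<forall>l\<in>neighborhood V E k. \<forall>i. \<theta>hat k l (Suc i) \<in> borel_measurable M"
    and initial: "\<forall>k\<in>Normal. integrable M (\<lambda>\<omega>. (norm (\<theta> k 0 \<omega>))\<^sup>2)"
    and atc: "\<forall>k\<in>Normal. atc_diffusion M (neighborhood V E k) k (\<mu> k) (\<theta> k) (g k) (\<theta>hat k) (\<lambda>l. a l k)"
    and normal_messages: "\<forall>k\<in>Normal. \<forall>l\<in>neighborhood V E k \<inter> Normal. \<forall>i. \<forall>\<omega>\<in>space M.
           \<theta>hat k l (Suc i) \<omega> = \<theta>hat l l (Suc i) \<omega>"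
    and constants: "m > 0" "L > 0" "\<forall>k\<in>Normal. c k \<ge> 1"
    and assumption1: "\<forall>k\<in>Normal. smooth_strongly_convex_risk m L (r k)"
    and assumption2: "\<forall>k\<in>Normal. unbiased_gradients M (r k) (\<theta> k) (g k)"
    and assumption3: "\<forall>k\<in>Normal. gradient_noise_bound M (\<sigma> k) (c k) (r k) (\<theta> k) (g k)"
  shows "(\<forall>k\<in>Normal.
            uses_loss_based_weights M (neighborhood V E k) k (r k) (\<theta>hat k) (\<lambda>l. a l k) \<longrightarrow>
            \<mu> k \<in> {0<..1 / (L * c k)} \<longrightarrow>
            limsup (\<lambda>i. ereal (\<integral>\<omega>. (r k (\<theta> k i \<omega>) - r k (\<theta>star k)) \<partial>M))
              \<le> ereal (\<mu> k * L * (\<sigma> k)\<^sup>2 / (2 * m)))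
       \<and> (\<forall>k\<in>Normal.
            uses_loss_based_weights M (neighborhood V E k) k (r k) (\<theta>hat k) (\<lambda>l. a l k) \<longrightarrow>
            (\<forall>i. integrable M (\<lambda>\<omega>. r k (\<theta> k i \<omega>) - r k (\<theta>star k)) \<and>
                 integrable M (\<lambda>\<omega>. r k (\<theta>hat k k (Suc i) \<omega>) - r k (\<theta>star k)) \<and>
                 (\<integral>\<omega>. (r k (\<theta> k (Suc i) \<omega>) - r k (\<theta>star k)) \<partial>M)
                   \<le> (\<integral>\<omega>. (r k (\<theta>hat k k (Suc i) \<omega>) - r k (\<theta>star k)) \<partial>M)))"
proof -
  interpret prob_space M by (rule prob)
  \<comment> \<open>All claims for one agent share the same integrability induction. The step size
    range is a premise of the last claim alone, since integrability and the comparison of the two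
    models hold for any \<open>\<mu> k\<close>.\<close>
  have main: "integrable M (\<lambda>\<omega>. r k (\<theta> k i \<omega>) - r k (\<theta>star k))"
    "integrable M (\<lambda>\<omega>. r k (\<theta>hat k k (Suc i) \<omega>) - r k (\<theta>star k))"
    "(\<integral>\<omega>. (r k (\<theta> k (Suc i) \<omega>) - r k (\<theta>star k)) \<partial>M)
       \<le> (\<integral>\<omega>. (r k (\<theta>hat k k (Suc i) \<omega>) - r k (\<theta>star k)) \<partial>M)"
    "\<mu> k \<in> {0<..1 / (L * c k)} \<Longrightarrow>
       limsup (\<lambda>i. ereal (\<integral>\<omega>. (r k (\<theta> k i \<omega>) - r k (\<theta>star k)) \<partial>M))
         \<le> ereal (\<mu> k * L * (\<sigma> k)\<^sup>2 / (2 * m))"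
    if k: "k \<in> Normal"
      and weights: "uses_loss_based_weights M (neighborhood V E k) k (r k) (\<theta>hat k) (\<lambda>l. a l k)"
    for k i
  proof -
    interpret noisy_gradient M m L "r k" "\<theta>star k" "\<theta> k" "g k" "\<sigma> k" "c k"
      using k constants assumption1 assumption2 assumption3 minimizer models_rv
      by unfold_locales auto
    have finite: "finite (neighborhood V E k)"
      using network unfolding agent_network_def neighborhood_def by simp
    have atc_k: "atc_diffusion M (neighborhood V E k) k (\<mu> k) (\<theta> k) (g k) (\<theta>hat k) (\<lambda>l. a l k)"
      using atc k by blast
    have adapt: "\<theta>hat k k (Suc i) \<omega> = \<theta> k i \<omega> - \<mu> k *\<^sub>R g k i \<omega>" if "\<omega> \<in> space M" for i \<omega>
      using atc_k that unfolding atc_diffusion_def by blast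
    have combine: "r k (\<theta> k (Suc i) \<omega>) \<le> r k (\<theta> k i \<omega> - \<mu> k *\<^sub>R g k i \<omega>)"
      if "\<omega> \<in> space M" for i \<omega>
      using loss_based_combination_le[OF smooth_strongly_convex_minimum_axioms finite that atc_k weights]
      by (simp add: adapt[OF that])
    \<comment> \<open>The induction carries the excess risk because received models have no moment
      assumption and the combination step controls risk, not distance. The new excess lies between 0
      and that of the adapted model; strong convexity recovers the second moment for the next
      step.\<close>
    have int: "integrable M (\<lambda>\<omega>. r k (\<theta> k i \<omega>) - r k (\<theta>star k))" for i
    proof (induction i)
      case 0
      have "integrable M (\<lambda>\<omega>. (norm (\<theta> k 0 \<omega> + (- \<theta>star k)))\<^sup>2)"
        using initial k by (intro square_integrable_add) auto
      then show ?case by (intro integrable_excess) auto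
    next
      case (Suc i)
      have "integrable M (\<lambda>\<omega>. r k (\<theta> k i \<omega> - \<mu> k *\<^sub>R g k i \<omega>) - r k (\<theta>star k))"
        using Suc by (intro integrable_excess_step square_integrable_dist) auto
      then show ?case
        by (rule Bochner_Integration.integrable_bound)
          (use combine minimum_le in \<open>auto intro!: AE_I2\<close>)
    qed
    have sq: "integrable M (\<lambda>\<omega>. (norm (\<theta> k i \<omega> - \<theta>star k))\<^sup>2)" for i
      using int by (intro square_integrable_dist) auto
    have mono: "(\<integral>\<omega>. (r k (\<theta> k (Suc i) \<omega>) - r k (\<theta>star k)) \<partial>M)
       \<le> (\<integral>\<omega>. (r k (\<theta> k i \<omega> - \<mu> k *\<^sub>R g k i \<omega>) - r k (\<theta>star k)) \<partial>M)" for i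
      using int integrable_excess_step[OF sq] combine by (intro integral_mono) auto
    show "integrable M (\<lambda>\<omega>. r k (\<theta> k i \<omega>) - r k (\<theta>star k))" by (rule int)
    \<comment> \<open>The adaptation equation is known only on \<open>space M\<close>; the
      congruence rules provide that membership.\<close>
    show "integrable M (\<lambda>\<omega>. r k (\<theta>hat k k (Suc i) \<omega>) - r k (\<theta>star k))"
      using integrable_excess_step[OF sq] by (simp add: adapt cong: Bochner_Integration.integrable_cong)
    show "(\<integral>\<omega>. (r k (\<theta> k (Suc i) \<omega>) - r k (\<theta>star k)) \<partial>M)
       \<le> (\<integral>\<omega>. (r k (\<theta>hat k k (Suc i) \<omega>) - r k (\<theta>star k)) \<partial>M)"
      using mono by (simp add: adapt cong: Bochner_Integration.integral_cong)
    assume "\<mu> k \<in> {0<..1 / (L * c k)}"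
    then have \<mu>: "0 < \<mu> k" "\<mu> k \<le> 1 / (L * c k)" by auto
    \<comment> \<open>Adding 1, the all-ones vector, gives a point different from the minimizer.
      With \<open>c k \<ge> 1\<close> and the step size bound, \<open>m \<le> L\<close> yields
      \<open>\<mu> k * m \<le> 1\<close>, so the contraction factor \<open>1 - \<mu> k * m\<close>
      lies between 0 and 1, the latter excluded.\<close>
    have "m \<le> L"
      using strong_convexity_le_Lipschitz[of "\<theta>star k + 1"] by simp
    then have "\<mu> k * m \<le> \<mu> k * (L * c k)"
      using \<mu>(1) L_pos c_ge_1 mult_left_mono[of 1 "c k" L]
      by (intro mult_left_mono) linarith+
    also have "\<dots> \<le> 1"
      using \<mu>(2) L_pos c_ge_1 by (simp add: pos_le_divide_eq)
    finally have "limsup (\<lambda>i. ereal (\<integral>\<omega>. (r k (\<theta> k i \<omega>) - r k (\<theta>star k)) \<partial>M))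
        \<le> ereal (L * (\<mu> k)\<^sup>2 / 2 * (\<sigma> k)\<^sup>2 / (1 - (1 - \<mu> k * m)))"
      using \<mu>(1) m_pos order_trans[OF mono expected_excess_step[OF sq \<mu>]]
      by (intro limsup_affine_recurrence) auto
    \<comment> \<open>The denominator is \<open>\<mu> k * m\<close>, so one factor
      \<open>\<mu> k\<close> of the additive error cancels and the stated bound remains.\<close>
    also have "L * (\<mu> k)\<^sup>2 / 2 * (\<sigma> k)\<^sup>2 / (1 - (1 - \<mu> k * m)) = \<mu> k * L * (\<sigma> k)\<^sup>2 / (2 * m)"
      using \<mu>(1) m_pos by (simp add: field_simps power2_eq_square)
    finally show "limsup (\<lambda>i. ereal (\<integral>\<omega>. (r k (\<theta> k i \<omega>) - r k (\<theta>star k)) \<partial>M))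
         \<le> ereal (\<mu> k * L * (\<sigma> k)\<^sup>2 / (2 * m))" .
  qed
  then show ?thesis by blast
qed

end
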